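(* Let $p\in(1/3,1)$ be a real number with $p\ne 1/2$. Then there exist a positive integer $m$ and a vector $w\in\mathbb{R}_{>0}^m$ with $\sum_{i=1}^m w_i=1$ such that, for $v=(v_1,\dots,v_m)\in\{0,1\}^m$ a random vector with i.i.d. Bernoulli$(p)$ coordinates, \[\mathbb{P}[\langle v,w\rangle\ge p]<p.\]
   Context: Here $\langle v,w\rangle=\sum_{i=1}^m w_iv_i$, and Bernoulli$(p)$ means taking value $1$ with probability $p$ and value $0$ with probability $1-p$. *)

theory Defs
  imports "HOL-Probability.Probability" "HOL-Probability.Product_PMF"
begin

text \<open>
  Vectors of length \<open>m\<close> are functions on \<^typ>\<open>nat\<close> whose relevant
  coordinates are \<open>1, \<dots>, m\<close>, since \<open>m\<close> is quantified inside statements.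
  The library's Bernoulli distribution is Boolean-valued; it is transported to the
  reals 0 and 1.
\<close>

definition iid_bernoulli_vector :: "nat \<Rightarrow> real \<Rightarrow> (nat \<Rightarrow> real) pmf" where
  "iid_bernoulli_vector m p = Pi_pmf {1..m} 0 (\<lambda>_. map_pmf of_bool (bernoulli_pmf p))"

definition vec_inner :: "nat \<Rightarrow> (nat \<Rightarrow> real) \<Rightarrow> (nat \<Rightarrow> real) \<Rightarrow> real" where
  "vec_inner m v w = (\<Sum>i=1..m. w i * v i)"

end

theory Submission
  imports Defs
begin

text \<open>
  Uniform weights suffice. For \<open>p > 1/2\<close> take \<open>m = 2\<close>: both coordinates must be 1, which has
  probability \<open>p\<^sup>2\<close>. For \<open>1/3 < p < 1/2\<close> take \<open>m = 3\<close>: at least two coordinates must be 1,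
  which has probability \<open>3p\<^sup>2 - 2p\<^sup>3\<close>, and \<open>p - (3p\<^sup>2 - 2p\<^sup>3) = p(1 - p)(1 - 2p)\<close>.
\<close>

lemma iid_bernoulli_vector_support:
  assumes "v \<in> set_pmf (iid_bernoulli_vector m p)" "i \<in> {1..m}"
  shows "v i = 0 \<or> v i = 1"
proof -
  have "v i \<in> set_pmf (map_pmf of_bool (bernoulli_pmf p))"
    using assms set_Pi_pmf[of "{1..m}" 0 "\<lambda>_. map_pmf of_bool (bernoulli_pmf p)"]
    unfolding iid_bernoulli_vector_def by (auto simp: PiE_dflt_def)
  then show ?thesis by auto
qed

text \<open>Independence makes the probability of a box factor over the coordinates. Each factor is
  pulled back along \<open>of_bool\<close>, so only probabilities of sets of Booleans
  remain.\<close>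

lemma prob_iid_bernoulli_vector_Pi:
  "measure_pmf.prob (iid_bernoulli_vector m p) (Pi {1..m} B) =
     (\<Prod>i=1..m. measure_pmf.prob (bernoulli_pmf p) {b. of_bool b \<in> B i})"
  unfolding iid_bernoulli_vector_def
  by (subst measure_Pi_pmf_Pi) (auto simp: vimage_def)

text \<open>Null points are irrelevant, so threshold events can be compared with boxes by looking at
  0/1 vectors only. For arbitrary real vectors such as \<open>(2, 0)\<close> the inclusions used
  below would fail.\<close>

lemma prob_le_if_subset_on_support:
  assumes "\<And>v. v \<in> set_pmf M \<Longrightarrow> v \<in> A \<Longrightarrow> v \<in> B"
  shows "measure_pmf.prob M A \<le> measure_pmf.prob M B"
  by (rule measure_pmf.finite_measure_mono_AE) (use assms in \<open>auto simp: AE_measure_pmf_iff\<close>)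

lemma prob_bernoulli_True: "0 \<le> p \<Longrightarrow> p \<le> 1 \<Longrightarrow> measure_pmf.prob (bernoulli_pmf p) {b. b} = p"
  and prob_bernoulli_False: "0 \<le> p \<Longrightarrow> p \<le> 1 \<Longrightarrow> measure_pmf.prob (bernoulli_pmf p) {b. \<not> b} = 1 - p"
proof -
  have "{b. b} = {True}" "{b. \<not> b} = {False}" by auto
  then show "0 \<le> p \<Longrightarrow> p \<le> 1 \<Longrightarrow> measure_pmf.prob (bernoulli_pmf p) {b. b} = p"
    and "0 \<le> p \<Longrightarrow> p \<le> 1 \<Longrightarrow> measure_pmf.prob (bernoulli_pmf p) {b. \<not> b} = 1 - p"
    by (simp_all add: measure_pmf_single)
qed

lemma prob_two_coordinates:
  assumes "1/2 < p" "p < 1"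
  shows "measure_pmf.prob (iid_bernoulli_vector 2 p) {v. vec_inner 2 v (\<lambda>_. 1/2) \<ge> p} < p"
proof -
  have "measure_pmf.prob (iid_bernoulli_vector 2 p) {v. vec_inner 2 v (\<lambda>_. 1/2) \<ge> p}
      \<le> measure_pmf.prob (iid_bernoulli_vector 2 p) (Pi {1..2} (\<lambda>_. {1}))"
  proof (rule prob_le_if_subset_on_support)
    fix v assume v: "v \<in> set_pmf (iid_bernoulli_vector 2 p)" "v \<in> {v. vec_inner 2 v (\<lambda>_. 1/2) \<ge> p}"
    have "v 1 = 0 \<or> v 1 = 1" "v 2 = 0 \<or> v 2 = 1"
      using iid_bernoulli_vector_support[OF v(1)] by auto
    moreover have "v 1 / 2 + v 2 / 2 \<ge> p"
      using v(2) by (simp add: vec_inner_def numeral_eq_Suc)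
    \<comment> \<open>A single zero coordinate already brings the average down to at most 1/2, which
      is below \<open>p\<close>.\<close>
    ultimately have "v 1 = 1" "v 2 = 1" using assms by auto
    then show "v \<in> Pi {1..2} (\<lambda>_. {1})" by (auto simp: le_Suc_eq numeral_eq_Suc)
  qed
  also have "\<dots> = p * p"
    unfolding prob_iid_bernoulli_vector_Pi using assms
    by (simp add: prob_bernoulli_True power2_eq_square)
  also have "\<dots> < p" using assms by simp
  finally show ?thesis .
qed

lemma prob_three_coordinates:
  assumes "1/3 < p" "p < 1/2"
  shows "measure_pmf.prob (iid_bernoulli_vector 3 p) {v. vec_inner 3 v (\<lambda>_. 1/3) \<ge> p} < p"
proof -
  let ?M = "iid_bernoulli_vector 3 p"
  \<comment> \<open>Among 0/1 vectors, the boxes cover exactly those with at least two ones: 110 and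
    111 lie in \<open>?A\<close>, 101 in \<open>?B\<close> and 011 in \<open>?C\<close>.\<close>
  let ?A = "Pi {1..3} (\<lambda>i::nat. if i = 3 then UNIV else {1::real})"
  let ?B = "Pi {1..3} (\<lambda>i::nat. if i = 2 then {0} else {1::real})"
  let ?C = "Pi {1..3} (\<lambda>i::nat. if i = 1 then {0} else {1::real})"
  have "measure_pmf.prob ?M {v. vec_inner 3 v (\<lambda>_. 1/3) \<ge> p} \<le> measure_pmf.prob ?M (?A \<union> ?B \<union> ?C)"
  proof (rule prob_le_if_subset_on_support)
    fix v assume v: "v \<in> set_pmf ?M" "v \<in> {v. vec_inner 3 v (\<lambda>_. 1/3) \<ge> p}"
    have "v 1 = 0 \<or> v 1 = 1" "v 2 = 0 \<or> v 2 = 1" "v 3 = 0 \<or> v 3 = 1"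
      using iid_bernoulli_vector_support[OF v(1)] by auto
    moreover have "v 1 / 3 + v 2 / 3 + v 3 / 3 \<ge> p"
      using v(2) by (simp add: vec_inner_def numeral_eq_Suc)
    \<comment> \<open>With at most one coordinate equal to 1 the average is at most 1/3; this is
      where \<open>1/3 < p\<close> enters.\<close>
    ultimately have "v 1 = 1 \<and> v 2 = 1 \<or> v 1 = 1 \<and> v 2 = 0 \<and> v 3 = 1 \<or> v 1 = 0 \<and> v 2 = 1 \<and> v 3 = 1"
      using assms by auto
    then show "v \<in> ?A \<union> ?B \<union> ?C" by (auto simp: Pi_def le_Suc_eq numeral_eq_Suc)
  qed
  \<comment> \<open>The boxes are pairwise disjoint, so the union bound loses nothing here.\<close>
  also have "\<dots> \<le> measure_pmf.prob ?M ?A + measure_pmf.prob ?M ?B + measure_pmf.prob ?M ?C"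
    by (intro order_trans[OF measure_Un_le] add_mono order_refl) auto
  also have "\<dots> = p * p + 2 * (p * (1 - p) * p)"
    unfolding prob_iid_bernoulli_vector_Pi using assms
    by (simp add: prob_bernoulli_True prob_bernoulli_False numeral_eq_Suc)
  also have "\<dots> < p"
  proof -
    \<comment> \<open>This product is the right-hand side minus the left-hand side of the
      goal.\<close>
    have "0 < p * (1 - p) * (1 - 2 * p)" using assms by simp
    then show ?thesis by (simp add: algebra_simps)
  qed
  finally show ?thesis .
qed

theorem proposition7:
  fixes p :: real
  assumes "1/3 < p" and "p < 1" and "p \<noteq> 1/2"
  shows "\<exists>(m::nat) (w :: nat \<Rightarrow> real).
           m > 0 \<and> (\<forall>i\<in>{1..m}. w i > 0) \<and> (\<Sum>i=1..m. w i) = 1 \<and>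
           measure_pmf.prob (iid_bernoulli_vector m p) {v. vec_inner m v w \<ge> p} < p"
proof (cases "p < 1/2")
  case True
  show ?thesis
    by (intro exI[of _ 3] exI[of _ "\<lambda>_. 1/3"]) (use prob_three_coordinates[OF assms(1) True] in simp)
next
  case False
  then have "1/2 < p" using assms by simp
  show ?thesis
    by (intro exI[of _ 2] exI[of _ "\<lambda>_. 1/2"])
      (use prob_two_coordinates[OF \<open>1/2 < p\<close> assms(2)] in simp)
qed

end
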